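(* Let $\mathscr{M}=(X,\mathcal{I})$ be a matroid on $|X|=n$ elements, let $\omega:X\to\mathbb{R}_{>0}$ be a weight function, and let $1\le k<\mathrm{rk}(\mathscr{M})$. Then $$\mathrm{I}_\omega(k)^2\ \ge\ \Bigl(1+\frac1k\Bigr)\Bigl(1+\frac{1}{p(k-1)-1}\Bigr)\,\mathrm{I}_\omega(k-1)\,\mathrm{I}_\omega(k+1).$$
   Context: A matroid $\mathscr{M}=(X,\mathcal{I})$ is given by its finite ground set $X$ and its collection $\mathcal I\subseteq 2^X$ of independent sets; $\mathrm{rk}(\mathscr M)$ is the maximal size of an independent set; $\mathcal I_j=\{S\in\mathcal I: |S|=j\}$. For $\omega:X\to\mathbb R_{>0}$ put $\omega(S)=\prod_{x\in S}\omega(x)$ and $\mathrm I_\omega(j)=\sum_{S\in\mathcal I_j}\omega(S)$. For $S\in\mathcal I$, the set of continuations is $\mathrm{Cont}(S)=\{x\in X\setminus S: S\cup\{x\}\in\mathcal I\}$. For $x,y\in\mathrm{Cont}(S)$ write $x\sim_S y$ if $x=y$ or $S\cup\{x,y\}\notin\mathcal I$; this is an equivalence relation on $\mathrm{Cont}(S)$. Its equivalence classes are called parallel classes of $S$, and $\mathrm{Par}(S)$ is the set of parallel classes. For $0\le j<\mathrm{rk}(\mathscr M)$, $p(j)=\max\{|\mathrm{Par}(S)|: S\in\mathcal I_j\}$. *)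

theory Defs
  imports Complex_Main
begin

locale matroid =
  fixes X :: "'a set" and \<I> :: "'a set set"
  assumes finite_ground: "finite X"
    and indep_subset_ground: "S \<in> \<I> \<Longrightarrow> S \<subseteq> X"
    and empty_indep: "{} \<in> \<I>"
    and subset_indep: "T \<in> \<I> \<Longrightarrow> S \<subseteq> T \<Longrightarrow> S \<in> \<I>"
    and augmentation: "S \<in> \<I> \<Longrightarrow> T \<in> \<I> \<Longrightarrow> card S < card T \<Longrightarrow> \<exists>x\<in>T - S. insert x S \<in> \<I>"

definition matroid_rank :: "'a set set \<Rightarrow> nat" where
  "matroid_rank \<I> = Max (card ` \<I>)"

definition indep_of_card :: "'a set set \<Rightarrow> nat \<Rightarrow> 'a set set" where
  "indep_of_card \<I> j = {S \<in> \<I>. card S = j}"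

definition weighted_indep :: "('a \<Rightarrow> real) \<Rightarrow> 'a set set \<Rightarrow> nat \<Rightarrow> real" where
  "weighted_indep \<omega> \<I> j = (\<Sum>S\<in>indep_of_card \<I> j. \<Prod>x\<in>S. \<omega> x)"

definition continuations :: "'a set \<Rightarrow> 'a set set \<Rightarrow> 'a set \<Rightarrow> 'a set" where
  "continuations X \<I> S = {x \<in> X - S. S \<union> {x} \<in> \<I>}"

definition parallel_rel :: "'a set \<Rightarrow> 'a set set \<Rightarrow> 'a set \<Rightarrow> ('a \<times> 'a) set" where
  "parallel_rel X \<I> S =
     {(x, y). x \<in> continuations X \<I> S \<and> y \<in> continuations X \<I> S \<and>
              (x = y \<or> S \<union> {x, y} \<notin> \<I>)}"

definition parallel_classes :: "'a set \<Rightarrow> 'a set set \<Rightarrow> 'a set \<Rightarrow> 'a set set" where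
  "parallel_classes X \<I> S = continuations X \<I> S // parallel_rel X \<I> S"

(* Only used for j < matroid_rank; beyond the rank the index set is empty and Max is unspecified. *)
definition max_parallel :: "'a set \<Rightarrow> 'a set set \<Rightarrow> nat \<Rightarrow> nat" where
  "max_parallel X \<I> j = Max ((\<lambda>S. card (parallel_classes X \<I> S)) ` indep_of_card \<I> j)"

context matroid
begin

lemma finite_indep: "S \<in> \<I> \<Longrightarrow> finite S"
  using finite_ground indep_subset_ground finite_subset by blast

lemma finite_indeps: "finite \<I>"
  using finite_ground indep_subset_ground by (meson PowI finite_Pow_iff finite_subset subsetI)

lemma equiv_parallel_rel:
  assumes S: "S \<in> \<I>"
  shows "equiv (continuations X \<I> S) (parallel_rel X \<I> S)"
proof (rule equivI)
  show "parallel_rel X \<I> S \<subseteq> continuations X \<I> S \<times> continuations X \<I> S"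
    by (auto simp: parallel_rel_def)
  show "refl_on (continuations X \<I> S) (parallel_rel X \<I> S)"
    by (auto simp: parallel_rel_def refl_on_def)
  show "sym (parallel_rel X \<I> S)"
    by (auto simp: parallel_rel_def sym_def insert_commute)
  show "trans (parallel_rel X \<I> S)"
  proof (rule transI)
    fix x y z
    assume xy: "(x, y) \<in> parallel_rel X \<I> S" and yz: "(y, z) \<in> parallel_rel X \<I> S"
    have c: "x \<in> continuations X \<I> S" "y \<in> continuations X \<I> S" "z \<in> continuations X \<I> S"
      using xy yz by (auto simp: parallel_rel_def)
    have "S \<union> {x, z} \<notin> \<I>" if ne: "x \<noteq> y" "y \<noteq> z" "x \<noteq> z"
    proof
      assume xz: "S \<union> {x, z} \<in> \<I>"
      have "card (S \<union> {y}) < card (S \<union> {x, z})"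
        using c ne finite_indep[OF S] by (simp add: continuations_def)
      with xz c obtain u where u: "u \<in> (S \<union> {x, z}) - (S \<union> {y})" "insert u (S \<union> {y}) \<in> \<I>"
        using augmentation[of "S \<union> {y}" "S \<union> {x, z}"] by (auto simp: continuations_def)
      then have "u = x \<or> u = z" by auto
      then show False
        using u xy yz ne by (auto simp: parallel_rel_def insert_commute)
    qed
    then show "(x, z) \<in> parallel_rel X \<I> S"
      using xy yz c by (auto simp: parallel_rel_def)
  qed
qed

end

end

theory Submission
  imports Defs "HOL-Analysis.Convex"
begin

text \<open>Call a symmetric form hyperbolic if it satisfies the reverse Cauchy--Schwarz inequality against
  vectors of positive norm. The inequality is this property, for \<open>(\<omega>, 0)\<close> and the unit vector of \<open>t\<close>,
  of the Hessian, at \<open>(\<omega>, 0)\<close>, of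
  \<open>F = I\<^sub>k\<^sub>+\<^sub>1 + t I\<^sub>k + (c/2) t\<^sup>2 I\<^sub>k\<^sub>-\<^sub>1\<close>, where \<open>c = 1 + 1/(p(k-1) - 1)\<close>.
  When all variables but two are differentiated away, along an independent \<open>S\<close> of size \<open>k - 1\<close>, the
  Hessian depends only on the parallel classes of \<open>S\<close>, and it is hyperbolic since \<open>1 - 1/c = 1/p(k-1)\<close>.
  In higher degree, Euler's formula writes the Hessian at \<open>t = 0\<close> as the positive combination
  \<open>\<Sum>\<^sub>x \<omega>\<^sub>x H\<^sub>x\<close> of the Hessians of the partial derivatives, and \<open>H\<^sub>x e\<^sub>y = H\<^sub>y e\<^sub>x\<close> by symmetry of third
  derivatives. Hence, for a partial sum \<open>H\<close> over a set \<open>J\<close> and a further element \<open>y\<close>, the functionals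
  \<open>H e\<^sub>y\<close> and \<open>H\<^sub>y (\<Sum>\<^sub>x\<^sub>\<in>\<^sub>J \<omega>\<^sub>x e\<^sub>x)\<close> coincide, both \<open>H\<close> and \<open>H\<^sub>y\<close> are negative semidefinite on their
  kernel, and so \<open>H + \<omega>\<^sub>y H\<^sub>y\<close> is hyperbolic. The functional does not vanish if the elements are
  added so that each is non-parallel to an earlier one.\<close>

section \<open>Bilinear forms and the reverse Cauchy--Schwarz inequality\<close>

definition bform :: "'b set \<Rightarrow> ('b \<Rightarrow> 'b \<Rightarrow> real) \<Rightarrow> ('b \<Rightarrow> real) \<Rightarrow> ('b \<Rightarrow> real) \<Rightarrow> real" where
  "bform Y A g h = (\<Sum>i\<in>Y. \<Sum>j\<in>Y. A i j * g i * h j)"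

text \<open>Equivalent, for symmetric \<open>A\<close>, to having at most one positive eigenvalue;
  degenerate forms and the zero form are included.\<close>

definition hyperbolic :: "'b set \<Rightarrow> ('b \<Rightarrow> 'b \<Rightarrow> real) \<Rightarrow> bool" where
  "hyperbolic Y A \<longleftrightarrow> (\<forall>i\<in>Y. \<forall>j\<in>Y. A i j = A j i) \<and>
     (\<forall>g h. bform Y A h h > 0 \<longrightarrow> bform Y A g g * bform Y A h h \<le> (bform Y A g h)\<^sup>2)"

lemma bform_lincomb_left:
  "bform Y A (\<lambda>i. g i + s * h i) f = bform Y A g f + s * bform Y A h f"
  by (simp add: bform_def sum_distrib_left sum.distrib algebra_simps)

lemma bform_lincomb_right:
  "bform Y A f (\<lambda>i. g i + s * h i) = bform Y A f g + s * bform Y A f h"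
  by (simp add: bform_def sum_distrib_left sum.distrib algebra_simps)

lemma bform_commute:
  assumes "\<And>i j. i \<in> Y \<Longrightarrow> j \<in> Y \<Longrightarrow> A i j = A j i"
  shows "bform Y A g h = bform Y A h g"
proof -
  have "bform Y A g h = (\<Sum>i\<in>Y. \<Sum>j\<in>Y. A j i * g i * h j)"
    unfolding bform_def by (intro sum.cong refl) (simp add: assms)
  also have "\<dots> = bform Y A h g"
    unfolding bform_def by (subst sum.swap) (simp add: mult.commute mult.left_commute)
  finally show ?thesis .
qed

lemma bform_lincomb_self:
  assumes "\<And>i j. i \<in> Y \<Longrightarrow> j \<in> Y \<Longrightarrow> A i j = A j i"
  shows "bform Y A (\<lambda>i. g i + s * h i) (\<lambda>i. g i + s * h i)
    = bform Y A g g + 2 * s * bform Y A g h + s\<^sup>2 * bform Y A h h"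
  using bform_commute[of Y A h g] assms
  by (simp add: bform_lincomb_left bform_lincomb_right power2_eq_square algebra_simps)

lemma bform_add_matrix:
  "bform Y (\<lambda>i j. A i j + B i j) g h = bform Y A g h + bform Y B g h"
  by (simp add: bform_def sum.distrib algebra_simps)

lemma bform_scale_matrix:
  "bform Y (\<lambda>i j. c * A i j) g h = c * bform Y A g h"
  by (simp add: bform_def sum_distrib_left algebra_simps)

lemma bform_indicator_left:
  assumes "finite Y" "y \<in> Y"
  shows "bform Y A (\<lambda>i. of_bool (i = y)) h = (\<Sum>j\<in>Y. A y j * h j)"
proof -
  have "bform Y A (\<lambda>i. of_bool (i = y)) h = (\<Sum>i\<in>Y. if i = y then \<Sum>j\<in>Y. A y j * h j else 0)"
    unfolding bform_def by (intro sum.cong refl) auto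
  then show ?thesis using assms by simp
qed

lemma bform_nonneg:
  assumes "\<And>i j. i \<in> Y \<Longrightarrow> j \<in> Y \<Longrightarrow> A i j \<ge> 0"
    and "\<And>i. i \<in> Y \<Longrightarrow> g i \<ge> 0" and "\<And>i. i \<in> Y \<Longrightarrow> h i \<ge> 0"
  shows "bform Y A g h \<ge> 0"
  unfolding bform_def using assms by (intro sum_nonneg mult_nonneg_nonneg)

text \<open>A multiple of \<open>h\<close> shifts \<open>g\<close> into the kernel of the functional
  \<open>r\<close>, where the form is nonpositive; multiplying by the norm of \<open>h\<close> and
  completing the square gives the inequality.\<close>

lemma hyperbolicI:
  assumes sym: "\<And>i j. i \<in> Y \<Longrightarrow> j \<in> Y \<Longrightarrow> A i j = A j i"
    and neg: "\<And>g. (\<Sum>i\<in>Y. r i * g i) = 0 \<Longrightarrow> bform Y A g g \<le> 0"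
  shows "hyperbolic Y A"
  unfolding hyperbolic_def
proof (intro conjI ballI allI impI)
  fix g h
  assume pos: "bform Y A h h > 0"
  define \<phi> where "\<phi> f = (\<Sum>i\<in>Y. r i * f i)" for f
  have \<phi>h: "\<phi> h \<noteq> 0" using neg[of h] pos by (auto simp: \<phi>_def)
  define s where "s = - \<phi> g / \<phi> h"
  have "\<phi> (\<lambda>i. g i + s * h i) = \<phi> g + s * \<phi> h"
    by (simp add: \<phi>_def sum.distrib sum_distrib_left algebra_simps)
  also have "\<dots> = 0" using \<phi>h by (simp add: s_def)
  finally have le: "bform Y A g g + 2 * s * bform Y A g h + s\<^sup>2 * bform Y A h h \<le> 0"
    using neg[of "\<lambda>i. g i + s * h i"] bform_lincomb_self[of Y A g s h] sym by (simp add: \<phi>_def)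
  have "bform Y A h h * (bform Y A g g + 2 * s * bform Y A g h + s\<^sup>2 * bform Y A h h)
      = bform Y A g g * bform Y A h h + (s * bform Y A h h + bform Y A g h)\<^sup>2 - (bform Y A g h)\<^sup>2"
    by (simp add: power2_eq_square algebra_simps)
  moreover have "bform Y A h h * (bform Y A g g + 2 * s * bform Y A g h + s\<^sup>2 * bform Y A h h) \<le> 0"
    using pos le by (simp add: mult_le_0_iff)
  ultimately show "bform Y A g g * bform Y A h h \<le> (bform Y A g h)\<^sup>2"
    using zero_le_power2[of "s * bform Y A h h + bform Y A g h"] by linarith
qed (use sym in auto)

text \<open>If \<open>g\<close> had positive norm, reverse Cauchy--Schwarz against \<open>g\<close>
  would force \<open>h\<close> to be isotropic. Moving \<open>h\<close> slightly towards or away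
  from \<open>z\<close> then violates the same inequality to first order.\<close>

lemma hyperbolic_nonpos_orthogonal:
  assumes hyp: "hyperbolic Y A" and hh: "bform Y A h h \<ge> 0"
    and hz: "bform Y A h z \<noteq> 0" and hg: "bform Y A h g = 0"
  shows "bform Y A g g \<le> 0"
proof (rule ccontr)
  assume "\<not> bform Y A g g \<le> 0"
  then have gg: "bform Y A g g > 0" by simp
  have sym: "\<And>i j. i \<in> Y \<Longrightarrow> j \<in> Y \<Longrightarrow> A i j = A j i" using hyp by (auto simp: hyperbolic_def)
  have rcs: "bform Y A f f * bform Y A g g \<le> (bform Y A f g)\<^sup>2" for f
    using hyp gg by (auto simp: hyperbolic_def)
  have h0: "bform Y A h h = 0"
    using rcs[of h] hh gg hg by (simp add: mult_le_0_iff)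
  define a b where "a = bform Y A h z" and "b = bform Y A z z * bform Y A g g - (bform Y A z g)\<^sup>2"
  have key: "2 * s * a * bform Y A g g + s\<^sup>2 * b \<le> 0" for s
    using rcs[of "\<lambda>i. h i + s * z i"] bform_lincomb_self[of Y A h s z] sym
    by (simp add: bform_lincomb_left[of _ _ _ _ _ g] h0 hg a_def b_def power_mult_distrib algebra_simps)
  \<comment> \<open>The sign of \<open>a\<close> makes the linear term positive; the denominator
    keeps the quadratic term smaller than it.\<close>
  define s where "s = a * bform Y A g g / (\<bar>b\<bar> + 1)"
  have apos: "a\<^sup>2 * (bform Y A g g)\<^sup>2 > 0" using hz gg by (simp add: a_def)
  have "2 * s * a * bform Y A g g + s\<^sup>2 * b
      = a\<^sup>2 * (bform Y A g g)\<^sup>2 / (\<bar>b\<bar> + 1) * (2 + b / (\<bar>b\<bar> + 1))"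
    by (simp add: s_def power2_eq_square divide_inverse algebra_simps del: inverse_eq_divide)
  moreover have "2 + b / (\<bar>b\<bar> + 1) > 0"
    by (simp add: field_simps abs_if)
  ultimately have "2 * s * a * bform Y A g g + s\<^sup>2 * b > 0"
    using apos by simp
  then show False using key[of s] by simp
qed

lemma hyperbolic_scale:
  assumes "hyperbolic Y A" "c > 0"
  shows "hyperbolic Y (\<lambda>i j. c * A i j)"
proof -
  have "c * a * (c * b) \<le> (c * d)\<^sup>2 \<longleftrightarrow> a * b \<le> d\<^sup>2" for a b d :: real
  proof -
    have eq: "c * a * (c * b) = c\<^sup>2 * (a * b)" by (simp add: power2_eq_square)
    show ?thesis unfolding eq power_mult_distrib using assms(2) by simp
  qed
  then show ?thesis
    using assms by (auto simp: hyperbolic_def bform_scale_matrix zero_less_mult_iff)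
qed

text \<open>The vectors \<open>p\<close> and \<open>q\<close> induce one common functional, nonzero
  because of \<open>z\<close>. Both forms are nonpositive on its kernel, hence so is their sum, and
  \<open>hyperbolicI\<close> applies.\<close>

lemma hyperbolic_add:
  assumes A: "hyperbolic Y A" and B: "hyperbolic Y B"
    and eq: "\<And>g. bform Y A p g = bform Y B q g"
    and "bform Y A p p \<ge> 0" and "bform Y B q q \<ge> 0" and "bform Y A p z \<noteq> 0"
  shows "hyperbolic Y (\<lambda>i j. A i j + B i j)"
proof (rule hyperbolicI)
  show "\<And>i j. i \<in> Y \<Longrightarrow> j \<in> Y \<Longrightarrow> A i j + B i j = A j i + B j i"
    using A B by (simp add: hyperbolic_def)
  fix g assume "(\<Sum>j\<in>Y. (\<Sum>i\<in>Y. A i j * p i) * g j) = 0"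
  then have "bform Y A p g = 0"
    unfolding bform_def by (subst sum.swap) (simp add: sum_distrib_right)
  then have "bform Y A g g \<le> 0" "bform Y B g g \<le> 0"
    using hyperbolic_nonpos_orthogonal[OF A, of p z g] hyperbolic_nonpos_orthogonal[OF B, of q z g] assms
    by auto
  then show "bform Y (\<lambda>i j. A i j + B i j) g g \<le> 0" by (simp add: bform_add_matrix)
qed

lemma hyperbolic_sum_insert:
  fixes A :: "'b \<Rightarrow> 'b \<Rightarrow> 'b \<Rightarrow> real"
  assumes fin: "finite Y" and J: "J \<subseteq> Y" and y: "y \<in> Y - J"
    and w: "\<And>x. x \<in> insert y J \<Longrightarrow> w x > 0"
    and nonneg: "\<And>x i j. x \<in> insert y J \<Longrightarrow> i \<in> Y \<Longrightarrow> j \<in> Y \<Longrightarrow> A x i j \<ge> 0"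
    and sym: "\<And>x j. x \<in> J \<Longrightarrow> j \<in> Y \<Longrightarrow> A x y j = A y x j"
    and hypJ: "hyperbolic Y (\<lambda>i j. \<Sum>x\<in>J. w x * A x i j)"
    and hypy: "hyperbolic Y (A y)"
    and conn: "x0 \<in> J" "j0 \<in> Y" "A x0 y j0 > 0"
  shows "hyperbolic Y (\<lambda>i j. \<Sum>x\<in>insert y J. w x * A x i j)"
proof -
  let ?A = "\<lambda>i j. \<Sum>x\<in>J. w x * A x i j" and ?B = "\<lambda>i j. w y * A y i j"
  \<comment> \<open>\<open>?q\<close> is divided by \<open>w y\<close> because \<open>?B\<close>
    carries that factor; by \<open>sym\<close> the functionals of \<open>?p\<close> under
    \<open>?A\<close> and of \<open>?q\<close> under \<open>?B\<close> then agree.\<close>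
  let ?p = "\<lambda>i. of_bool (i = y) :: real" and ?q = "\<lambda>i. if i \<in> J then w i / w y else 0"
  have finJ: "finite J" using J fin finite_subset by blast
  have wy: "w y > 0" using w by simp
  have Ap: "bform Y ?A ?p g = (\<Sum>j\<in>Y. (\<Sum>x\<in>J. w x * A x y j) * g j)" for g
    using fin y by (simp add: bform_indicator_left)
  have "hyperbolic Y (\<lambda>i j. ?A i j + ?B i j)"
  proof (rule hyperbolic_add[OF hypJ hyperbolic_scale[OF hypy wy]])
    fix g
    have "bform Y ?B ?q g = (\<Sum>j\<in>Y. \<Sum>i\<in>Y. if i \<in> J then w i * A y i j * g j else 0)"
      unfolding bform_def using wy by (subst sum.swap, intro sum.cong refl) simp
    also have "\<dots> = (\<Sum>j\<in>Y. \<Sum>i\<in>J. w i * A y i j * g j)"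
      using fin J by (simp add: sum.inter_restrict[symmetric] inf.absorb2)
    also have "\<dots> = bform Y ?A ?p g"
      unfolding Ap sum_distrib_right by (intro sum.cong refl) (simp add: sym)
    finally show "bform Y ?A ?p g = bform Y ?B ?q g" by simp
  next
    show "bform Y ?A ?p ?p \<ge> 0"
      using nonneg w by (intro bform_nonneg sum_nonneg mult_nonneg_nonneg) (auto intro: less_imp_le)
    show "bform Y ?B ?q ?q \<ge> 0"
      using nonneg w by (intro bform_nonneg mult_nonneg_nonneg) (auto intro: less_imp_le)
    have "bform Y ?A ?p (\<lambda>j. of_bool (j = j0)) = (\<Sum>x\<in>J. w x * A x y j0)"
      unfolding Ap using fin conn(2) by (simp add: of_bool_def if_distrib cong: if_cong)
    also have "\<dots> > 0"
      using finJ conn y nonneg w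
      by (intro sum_pos2[of J x0]) (auto intro!: mult_nonneg_nonneg less_imp_le[OF w])
    finally show "bform Y ?A ?p (\<lambda>j. of_bool (j = j0)) \<noteq> 0" by simp
  qed
  then show ?thesis using finJ y by (simp add: add.commute)
qed

text \<open>Once \<open>a\<close> and \<open>b\<close> are in the partial sum, every other element
  has a positive entry in column \<open>j0\<close> with one of them, so the rest can be added in any
  order.\<close>

lemma hyperbolic_sum:
  fixes A :: "'b \<Rightarrow> 'b \<Rightarrow> 'b \<Rightarrow> real"
  assumes fin: "finite Y" and K: "K \<subseteq> Y" and j0: "j0 \<in> Y"
    and w: "\<And>x. x \<in> K \<Longrightarrow> w x > 0"
    and nonneg: "\<And>x i j. x \<in> K \<Longrightarrow> i \<in> Y \<Longrightarrow> j \<in> Y \<Longrightarrow> A x i j \<ge> 0"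
    and sym: "\<And>x y j. x \<in> K \<Longrightarrow> y \<in> K \<Longrightarrow> j \<in> Y \<Longrightarrow> A x y j = A y x j"
    and hyp: "\<And>x. x \<in> K \<Longrightarrow> hyperbolic Y (A x)"
    and ab: "a \<in> K" "b \<in> K" "a \<noteq> b" "A a b j0 > 0"
    and conn: "\<And>x. x \<in> K \<Longrightarrow> A a x j0 > 0 \<or> A b x j0 > 0"
  shows "hyperbolic Y (\<lambda>i j. \<Sum>x\<in>K. w x * A x i j)"
proof -
  have step: "hyperbolic Y (\<lambda>i j. \<Sum>x\<in>insert y J. w x * A x i j)"
    if "J \<subseteq> K" "y \<in> K - J" "hyperbolic Y (\<lambda>i j. \<Sum>x\<in>J. w x * A x i j)"
      "x0 \<in> J" "A x0 y j0 > 0" for J y x0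
    using that K fin w nonneg sym hyp j0
    by (intro hyperbolic_sum_insert[of Y J y w A x0 j0]) auto
  have start: "hyperbolic Y (\<lambda>i j. \<Sum>x\<in>insert b {a}. w x * A x i j)"
    using ab hyperbolic_scale[OF hyp w] by (intro step[of "{a}" b a]) auto
  have fK: "finite (K - {a, b})" using fin K finite_subset by blast
  have "J \<subseteq> K - {a, b} \<Longrightarrow> hyperbolic Y (\<lambda>i j. \<Sum>x\<in>J \<union> {a, b}. w x * A x i j)"
    if "finite J" for J
    using that
  proof induction
    case empty
    then show ?case using start by (simp add: insert_commute)
  next
    case (insert y J)
    have "A a y j0 > 0 \<or> A b y j0 > 0" using insert conn by auto
    then have "hyperbolic Y (\<lambda>i j. \<Sum>x\<in>insert y (J \<union> {a, b}). w x * A x i j)"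
      using insert ab step[of "J \<union> {a, b}" y a] step[of "J \<union> {a, b}" y b] by auto
    then show ?case by (simp add: insert_commute)
  qed
  from this[OF fK] have "hyperbolic Y (\<lambda>i j. \<Sum>x\<in>(K - {a, b}) \<union> {a, b}. w x * A x i j)" by simp
  moreover have "(K - {a, b}) \<union> {a, b} = K" using ab by auto
  ultimately show ?thesis by simp
qed

section \<open>Weighted counts of extensions and the Hessian matrices\<close>

text \<open>Words are ordered, so every \<open>m\<close>-element independent extension of \<open>T\<close> is counted \<open>m!\<close> times.\<close>

fun word_weight :: "('a \<Rightarrow> real) \<Rightarrow> 'a set \<Rightarrow> 'a set set \<Rightarrow> nat \<Rightarrow> 'a set \<Rightarrow> real" where
  "word_weight \<omega> X \<I> 0 T = of_bool (T \<in> \<I>)"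
| "word_weight \<omega> X \<I> (Suc m) T = (\<Sum>x\<in>X - T. \<omega> x * word_weight \<omega> X \<I> m (insert x T))"

text \<open>The index \<open>None\<close> stands for a homogenizing variable \<open>t\<close>. With \<open>k = |S| + m + 1\<close> and \<open>I\<^sub>j\<close> the
  generating polynomial of the independent sets of size \<open>j\<close>, the matrix is \<open>m!\<close> times the Hessian, at
  \<open>(\<omega>, t = 0)\<close>, of the derivative along \<open>S\<close> of \<open>I\<^sub>k\<^sub>+\<^sub>1 + t I\<^sub>k + (c/2) t\<^sup>2 I\<^sub>k\<^sub>-\<^sub>1\<close>.\<close>

fun atlas :: "('a \<Rightarrow> real) \<Rightarrow> 'a set \<Rightarrow> 'a set set \<Rightarrow> real \<Rightarrow> nat \<Rightarrow> 'a set
    \<Rightarrow> 'a option \<Rightarrow> 'a option \<Rightarrow> real" where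
  "atlas \<omega> X \<I> c m S (Some x) (Some y) =
     of_bool (x \<noteq> y \<and> x \<notin> S \<and> y \<notin> S) * word_weight \<omega> X \<I> m (insert x (insert y S))"
| "atlas \<omega> X \<I> c m S (Some x) None = of_bool (x \<notin> S) * word_weight \<omega> X \<I> m (insert x S)"
| "atlas \<omega> X \<I> c m S None (Some x) = of_bool (x \<notin> S) * word_weight \<omega> X \<I> m (insert x S)"
| "atlas \<omega> X \<I> c m S None None = c * word_weight \<omega> X \<I> m S"

abbreviation atlas_index :: "'a set \<Rightarrow> 'a option set" where
  "atlas_index X \<equiv> insert None (Some ` X)"

lemma atlas_sym: "atlas \<omega> X \<I> c m S i j = atlas \<omega> X \<I> c m S j i"
  by (cases i; cases j) (auto simp: insert_commute)

lemma bform_atlas_index: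
  assumes "finite X" and sym: "\<And>x. A None (Some x) = A (Some x) None"
  shows "bform (atlas_index X) A g h =
    (\<Sum>x\<in>X. \<Sum>y\<in>X. A (Some x) (Some y) * g (Some x) * h (Some y))
    + (\<Sum>x\<in>X. A (Some x) None * g (Some x)) * h None
    + g None * (\<Sum>x\<in>X. A (Some x) None * h (Some x)) + A None None * g None * h None"
proof -
  have ins: "sum f (atlas_index X) = f None + (\<Sum>x\<in>X. f (Some x))" for f :: "'a option \<Rightarrow> real"
    using assms by (simp add: sum.reindex)
  show ?thesis
    unfolding bform_def ins
    by (simp add: sym sum.distrib sum_distrib_left sum_distrib_right mult_ac)
qed

context matroid
begin

lemma extend_indep:
  assumes "T \<in> \<I>" "card T < matroid_rank \<I>"
  obtains x where "x \<in> X - T" "insert x T \<in> \<I>"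
proof -
  have "matroid_rank \<I> \<in> card ` \<I>"
    unfolding matroid_rank_def using finite_indeps empty_indep by (intro Max_in) auto
  then obtain B where B: "B \<in> \<I>" "card T < card B" using assms by auto
  then obtain x where "x \<in> B - T" "insert x T \<in> \<I>" using augmentation assms by blast
  then show ?thesis using that B indep_subset_ground by blast
qed

lemma ex_indep_of_card:
  "j \<le> matroid_rank \<I> \<Longrightarrow> \<exists>S\<in>\<I>. card S = j"
proof (induction j)
  case 0
  then show ?case using empty_indep by (intro bexI[of _ "{}"]) auto
next
  case (Suc j)
  then obtain S where S: "S \<in> \<I>" "card S = j" by auto
  with Suc extend_indep obtain x where "x \<in> X - S" "insert x S \<in> \<I>" by (metis Suc_le_lessD)
  then show ?case using S finite_indep by (intro bexI[of _ "insert x S"]) auto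
qed

lemma extend_indep_twice:
  assumes "S \<in> \<I>" "card S + 2 \<le> matroid_rank \<I>"
  obtains x y where "x \<in> X - S" "y \<in> X - S" "x \<noteq> y" "insert x (insert y S) \<in> \<I>"
proof -
  obtain y where y: "y \<in> X - S" "insert y S \<in> \<I>" using extend_indep[of S] assms by auto
  have "card (insert y S) < matroid_rank \<I>" using y assms finite_indep by simp
  then obtain x where "x \<in> X - insert y S" "insert x (insert y S) \<in> \<I>" using extend_indep y by metis
  then show ?thesis using that y by blast
qed

lemma word_weight_nonneg:
  assumes "\<And>x. x \<in> X \<Longrightarrow> \<omega> x > 0"
  shows "word_weight \<omega> X \<I> m T \<ge> 0"
  by (induction m arbitrary: T) (auto intro!: sum_nonneg mult_nonneg_nonneg less_imp_le[OF assms])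

lemma word_weight_eq_0: "T \<notin> \<I> \<Longrightarrow> word_weight \<omega> X \<I> m T = 0"
proof (induction m arbitrary: T)
  case (Suc m)
  then have "insert x T \<notin> \<I>" for x using subset_indep by blast
  then show ?case using Suc.IH by simp
qed simp

lemma word_weight_pos:
  assumes pos: "\<And>x. x \<in> X \<Longrightarrow> \<omega> x > 0"
  shows "T \<in> \<I> \<Longrightarrow> card T + m \<le> matroid_rank \<I> \<Longrightarrow> word_weight \<omega> X \<I> m T > 0"
proof (induction m arbitrary: T)
  case (Suc m)
  then obtain x where x: "x \<in> X - T" "insert x T \<in> \<I>" using extend_indep[of T] by auto
  then have "word_weight \<omega> X \<I> m (insert x T) > 0" using Suc finite_indep by simp
  then show ?case
    using x finite_ground pos
    by (auto intro!: sum_pos2[of _ x] mult_nonneg_nonneg word_weight_nonneg less_imp_le[OF pos])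
qed simp

lemma atlas_nonneg:
  assumes "\<And>x. x \<in> X \<Longrightarrow> \<omega> x > 0" "c \<ge> 0"
  shows "atlas \<omega> X \<I> c m S i j \<ge> 0"
  using word_weight_nonneg[OF assms(1)] assms(2) by (cases i; cases j) auto

lemma atlas_eq_0:
  assumes "S \<notin> \<I>"
  shows "atlas \<omega> X \<I> c m S i j = 0"
proof -
  have "word_weight \<omega> X \<I> m T = 0" if "S \<subseteq> T" for T
    using assms that subset_indep word_weight_eq_0 by metis
  from this[of S] this[of "insert x S" for x] this[of "insert x (insert y S)" for x y]
  show ?thesis by (cases i; cases j) auto
qed

text \<open>Symmetry of third derivatives, in the form that \<open>hyperbolic_sum\<close>
  requires.\<close>

lemma atlas_exchange:
  assumes "x \<notin> S" "y \<notin> S"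
  shows "atlas \<omega> X \<I> c m (insert x S) (Some y) j = atlas \<omega> X \<I> c m (insert y S) (Some x) j"
  using assms by (cases j) (auto simp: insert_commute)

text \<open>Euler's formula for the Hessian of a homogeneous polynomial at \<open>t = 0\<close>.\<close>

lemma atlas_Suc:
  "atlas \<omega> X \<I> c (Suc m) S i j = (\<Sum>z\<in>X - S. \<omega> z * atlas \<omega> X \<I> c m (insert z S) i j)"
proof (cases i; cases j)
  fix x y assume ij: "i = Some x" "j = Some y"
  have "(\<Sum>z\<in>X - insert x (insert y S). \<omega> z * word_weight \<omega> X \<I> m (insert z (insert x (insert y S))))
      = (\<Sum>z\<in>X - S. \<omega> z * atlas \<omega> X \<I> c m (insert z S) i j)" if "x \<noteq> y" "x \<notin> S" "y \<notin> S"
    using that finite_ground ij by (intro sum.mono_neutral_cong_left) (auto simp: insert_commute)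
  then show ?thesis by (cases "x \<noteq> y \<and> x \<notin> S \<and> y \<notin> S") (auto simp: ij intro!: sum.neutral)
next
  fix x assume ij: "i = Some x" "j = None"
  have "(\<Sum>z\<in>X - insert x S. \<omega> z * word_weight \<omega> X \<I> m (insert z (insert x S)))
      = (\<Sum>z\<in>X - S. \<omega> z * atlas \<omega> X \<I> c m (insert z S) i j)" if "x \<notin> S"
    using that finite_ground ij by (intro sum.mono_neutral_cong_left) (auto simp: insert_commute)
  then show ?thesis by (cases "x \<notin> S") (auto simp: ij intro!: sum.neutral)
next
  fix x assume ij: "i = None" "j = Some x"
  have "(\<Sum>z\<in>X - insert x S. \<omega> z * word_weight \<omega> X \<I> m (insert z (insert x S)))
      = (\<Sum>z\<in>X - S. \<omega> z * atlas \<omega> X \<I> c m (insert z S) i j)" if "x \<notin> S"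
    using that finite_ground ij by (intro sum.mono_neutral_cong_left) (auto simp: insert_commute)
  then show ?thesis by (cases "x \<notin> S") (auto simp: ij intro!: sum.neutral)
qed (simp add: sum_distrib_left mult_ac)

section \<open>Parallel classes and the quadratic base case\<close>

lemma card_parallel_classes_le:
  assumes "S \<in> \<I>"
  shows "card (parallel_classes X \<I> S) \<le> max_parallel X \<I> (card S)"
  unfolding max_parallel_def indep_of_card_def using assms finite_indeps by (intro Max_ge) auto

lemma finite_continuations: "finite (continuations X \<I> S)"
  using finite_ground by (simp add: continuations_def)

lemma finite_parallel_classes:
  assumes "S \<in> \<I>"
  shows "finite (parallel_classes X \<I> S)"
  unfolding parallel_classes_def
  using finite_continuations equiv_parallel_rel[OF assms] by (intro finite_quotient) (auto simp: equiv_def)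

text \<open>Two elements that extend \<open>S\<close> together lie in different classes. This keeps
  the denominator \<open>p - 1\<close> in the constant positive.\<close>

lemma max_parallel_ge_2:
  assumes "j + 2 \<le> matroid_rank \<I>"
  shows "max_parallel X \<I> j \<ge> 2"
proof -
  obtain S where S: "S \<in> \<I>" "card S = j" using ex_indep_of_card[of j] assms by auto
  then obtain x y where xy: "x \<in> X - S" "y \<in> X - S" "x \<noteq> y" "insert x (insert y S) \<in> \<I>"
    using extend_indep_twice assms by metis
  let ?r = "parallel_rel X \<I> S"
  have cont: "x \<in> continuations X \<I> S" "y \<in> continuations X \<I> S"
    using xy subset_indep[OF xy(4)] by (auto simp: continuations_def)
  have "(x, y) \<notin> ?r" using xy by (auto simp: parallel_rel_def)
  then have "?r `` {x} \<noteq> ?r `` {y}"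
    using cont equiv_parallel_rel[OF S(1)] eq_equiv_class_iff by metis
  moreover have "{?r `` {x}, ?r `` {y}} \<subseteq> parallel_classes X \<I> S"
    using cont by (auto simp: parallel_classes_def intro: quotientI)
  ultimately have "2 \<le> card (parallel_classes X \<I> S)"
    using card_mono[OF finite_parallel_classes[OF S(1)]] by (metis card_2_iff)
  also have "\<dots> \<le> max_parallel X \<I> j" using card_parallel_classes_le[OF S(1)] S(2) by simp
  finally show ?thesis .
qed

text \<open>The matrix of the parallel relation is block diagonal with all-ones blocks, one for each
  class.\<close>

lemma sum_parallel_rel:
  fixes f :: "'a \<Rightarrow> real"
  assumes S: "S \<in> \<I>"
  defines "C \<equiv> continuations X \<I> S" and "r \<equiv> parallel_rel X \<I> S"
  shows "(\<Sum>x\<in>C. \<Sum>y\<in>C. of_bool ((x, y) \<in> r) * f x * f y)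
      = (\<Sum>P\<in>parallel_classes X \<I> S. (sum f P)\<^sup>2)"
    and "sum f C = (\<Sum>P\<in>parallel_classes X \<I> S. sum f P)"
proof -
  have eq: "equiv C r" unfolding C_def r_def by (rule equiv_parallel_rel[OF S])
  have finC: "finite C" unfolding C_def by (rule finite_continuations)
  have rC: "r \<subseteq> C \<times> C" by (auto simp: r_def C_def parallel_rel_def)
  have par: "parallel_classes X \<I> S = C // r" by (simp add: parallel_classes_def C_def r_def)
  have un: "\<Union>(parallel_classes X \<I> S) = C"
    unfolding par by (rule Union_quotient[OF eq])
  have finP: "\<forall>P\<in>parallel_classes X \<I> S. finite P"
  proof
    fix P assume "P \<in> parallel_classes X \<I> S"
    then have "P \<subseteq> C" using un by auto
    then show "finite P" using finC by (rule finite_subset)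
  qed
  have disj: "\<forall>P\<in>parallel_classes X \<I> S. \<forall>Q\<in>parallel_classes X \<I> S. P \<noteq> Q \<longrightarrow> P \<inter> Q = {}"
    unfolding par using quotient_disj[OF eq] by auto
  have split: "sum g C = (\<Sum>P\<in>parallel_classes X \<I> S. sum g P)" for g :: "'a \<Rightarrow> real"
    using sum.Union_disjoint[OF finP disj, of g] un by simp
  have "(\<Sum>x\<in>C. \<Sum>y\<in>C. of_bool ((x, y) \<in> r) * f x * f y) = (\<Sum>x\<in>C. f x * sum f (r `` {x}))"
  proof (rule sum.cong[OF refl])
    fix x
    have "sum f (r `` {x}) = (\<Sum>y\<in>C. of_bool ((x, y) \<in> r) * f y)"
      using rC finC by (intro sum.mono_neutral_cong_left) auto
    then show "(\<Sum>y\<in>C. of_bool ((x, y) \<in> r) * f x * f y) = f x * sum f (r `` {x})"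
      by (simp add: sum_distrib_left mult_ac)
  qed
  also have "\<dots> = (\<Sum>P\<in>parallel_classes X \<I> S. \<Sum>x\<in>P. f x * sum f (r `` {x}))" by (rule split)
  also have "\<dots> = (\<Sum>P\<in>parallel_classes X \<I> S. (sum f P)\<^sup>2)"
  proof (rule sum.cong[OF refl])
    fix P assume "P \<in> parallel_classes X \<I> S"
    then obtain z where "P = r `` {z}"
      unfolding par by (rule quotientE)
    then have "r `` {x} = P" if "x \<in> P" for x
      using that equiv_class_eq[OF eq, of z x] by simp
    then show "(\<Sum>x\<in>P. f x * sum f (r `` {x})) = (sum f P)\<^sup>2"
      by (simp add: power2_eq_square sum_distrib_right)
  qed
  finally show "(\<Sum>x\<in>C. \<Sum>y\<in>C. of_bool ((x, y) \<in> r) * f x * f y)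
      = (\<Sum>P\<in>parallel_classes X \<I> S. (sum f P)\<^sup>2)" .
  show "sum f C = (\<Sum>P\<in>parallel_classes X \<I> S. sum f P)" by (rule split)
qed

text \<open>On \<open>s + c t = 0\<close>, with \<open>s\<close> the sum of the coordinates over the continuations, the form equals
  \<open>s\<^sup>2 (1 - 1/c)\<close> minus the sum of the squares of the class sums, and \<open>1 - 1/c = 1/p\<close>.\<close>

lemma hyperbolic_atlas_0:
  assumes S: "S \<in> \<I>" and p: "card (parallel_classes X \<I> S) \<le> p" "2 \<le> p"
  shows "hyperbolic (atlas_index X) (atlas \<omega> X \<I> (1 + 1 / (real p - 1)) 0 S)"
proof (rule hyperbolicI)
  define c where "c = 1 + 1 / (real p - 1)"
  have p2: "real p \<ge> 2" using p by simp
  have cp: "c * real p = c + real p"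
    using p2 by (simp add: c_def field_simps)
  let ?A = "atlas \<omega> X \<I> c 0 S"
  let ?C = "continuations X \<I> S" and ?r = "parallel_rel X \<I> S" and ?P = "parallel_classes X \<I> S"
  fix g :: "'a option \<Rightarrow> real"
  define f where "f x = g (Some x)" for x
  define s where "s = sum f ?C"
  have CX: "?C \<subseteq> X" by (auto simp: continuations_def)
  have linear: "(\<Sum>x\<in>X. of_bool (x \<in> ?C) * f x) = s"
    unfolding s_def using CX finite_ground by (intro sum.mono_neutral_cong_right) auto
  have null: "?A (Some x) None = of_bool (x \<in> ?C)" if "x \<in> X" for x
    using that by (auto simp: continuations_def)
  \<comment> \<open>The zero diagonal is covered too, since the relation is reflexive: on
    continuations the matrix is all-ones minus the class blocks.\<close>
  have entry: "?A (Some x) (Some y) = 1 - of_bool ((x, y) \<in> ?r)" if "x \<in> ?C" "y \<in> ?C" for x y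
    using that by (auto simp: continuations_def parallel_rel_def)
  have entry0: "?A (Some x) (Some y) = 0" if "x \<notin> ?C \<or> y \<notin> ?C" "x \<in> X" "y \<in> X" for x y
    using that subset_indep[of "insert x (insert y S)" "insert x S"]
      subset_indep[of "insert x (insert y S)" "insert y S"] by (auto simp: continuations_def)
  have "(\<Sum>x\<in>X. \<Sum>y\<in>X. ?A (Some x) (Some y) * f x * f y)
      = (\<Sum>x\<in>?C. \<Sum>y\<in>?C. ?A (Some x) (Some y) * f x * f y)"
    (is "sum ?F X = _")
  proof -
    have "sum ?F X = sum ?F ?C"
      using CX finite_ground entry0 by (intro sum.mono_neutral_right ballI sum.neutral) auto
    also have "\<dots> = (\<Sum>x\<in>?C. \<Sum>y\<in>?C. ?A (Some x) (Some y) * f x * f y)"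
    proof (rule sum.cong[OF refl])
      fix x assume "x \<in> ?C"
      then have "?A (Some x) (Some y) = 0" if "y \<in> X - ?C" for y using that CX entry0 by blast
      then show "?F x = (\<Sum>y\<in>?C. ?A (Some x) (Some y) * f x * f y)"
        using CX finite_ground by (intro sum.mono_neutral_right) (auto simp del: atlas.simps)
    qed
    finally show ?thesis .
  qed
  also have "\<dots> = (\<Sum>x\<in>?C. \<Sum>y\<in>?C. f x * f y) - (\<Sum>x\<in>?C. \<Sum>y\<in>?C. of_bool ((x, y) \<in> ?r) * f x * f y)"
    by (simp add: entry sum_subtractf[symmetric] left_diff_distrib del: atlas.simps cong: sum.cong)
  also have "\<dots> = s\<^sup>2 - (\<Sum>P\<in>?P. (sum f P)\<^sup>2)"
    by (simp add: sum_parallel_rel(1)[OF S] s_def power2_eq_square sum_product)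
  finally have quad: "(\<Sum>x\<in>X. \<Sum>y\<in>X. ?A (Some x) (Some y) * f x * f y) = s\<^sup>2 - (\<Sum>P\<in>?P. (sum f P)\<^sup>2)" .
  have form: "bform (atlas_index X) ?A g g = s\<^sup>2 - (\<Sum>P\<in>?P. (sum f P)\<^sup>2) + 2 * s * g None + c * (g None)\<^sup>2"
    using bform_atlas_index[OF finite_ground, of ?A g g] quad linear S
    by (simp add: f_def[symmetric] null power2_eq_square del: atlas.simps(2,3) cong: sum.cong)
      (simp add: atlas_sym)
  \<comment> \<open>The functional is the \<open>None\<close> row of the matrix, that is, pairing
    with the unit vector of \<open>t\<close>.\<close>
  assume "(\<Sum>i\<in>atlas_index X.
    (case i of None \<Rightarrow> 1 + 1 / (real p - 1) | Some x \<Rightarrow> of_bool (x \<in> ?C)) * g i) = 0"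
  then have sc: "s = - c * g None"
    using finite_ground linear by (simp add: sum.reindex f_def[symmetric] c_def[symmetric] del: sum_of_bool_mult_eq)
  \<comment> \<open>Cauchy--Schwarz over the classes; the bound \<open>p\<close> on their number
    enters here.\<close>
  have "s\<^sup>2 \<le> real p * (\<Sum>P\<in>?P. (sum f P)\<^sup>2)"
  proof -
    have "s\<^sup>2 \<le> (\<Sum>P\<in>?P. (sum f P)\<^sup>2) * real (card ?P)"
      unfolding s_def sum_parallel_rel(2)[OF S]
      by (rule sum_squared_le_sum_of_squares)
    also have "\<dots> \<le> (\<Sum>P\<in>?P. (sum f P)\<^sup>2) * real p"
      using p by (intro mult_left_mono sum_nonneg) auto
    finally show ?thesis by (simp add: mult.commute)
  qed
  moreover have "real p * (s\<^sup>2 + 2 * s * g None + c * (g None)\<^sup>2) = s\<^sup>2"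
  proof -
    have "real p * (s\<^sup>2 + 2 * s * g None + c * (g None)\<^sup>2) = (c * real p - real p) * (c * (g None)\<^sup>2)"
      by (simp add: sc power2_eq_square algebra_simps)
    then show ?thesis by (simp add: cp sc power2_eq_square)
  qed
  ultimately have "real p * bform (atlas_index X) ?A g g \<le> 0"
    unfolding form by (simp add: algebra_simps)
  then show "bform (atlas_index X) (atlas \<omega> X \<I> (1 + 1 / (real p - 1)) 0 S) g g \<le> 0"
    using p2 by (simp add: c_def mult_le_0_iff)
qed (rule atlas_sym)

section \<open>Induction on the degree\<close>

text \<open>Each step removes one element from \<open>S\<close> and raises \<open>m\<close>: the
  matrix at \<open>S\<close> is the weighted sum of those at \<open>insert z S\<close>, to which
  \<open>hyperbolic_sum\<close> applies with \<open>None\<close> as the test column.\<close>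

lemma hyperbolic_atlas:
  assumes pos: "\<And>x. x \<in> X \<Longrightarrow> \<omega> x > 0" and c: "c \<ge> 0"
    and base: "\<And>S. S \<in> \<I> \<Longrightarrow> card S = k \<Longrightarrow> hyperbolic (atlas_index X) (atlas \<omega> X \<I> c 0 S)"
    and rank: "k + 2 \<le> matroid_rank \<I>"
  shows "S \<in> \<I> \<Longrightarrow> card S + m = k \<Longrightarrow> hyperbolic (atlas_index X) (atlas \<omega> X \<I> c m S)"
proof (induction m arbitrary: S)
  case 0
  then show ?case using base by simp
next
  case (Suc m)
  let ?A = "\<lambda>i. atlas \<omega> X \<I> c m (insert (the i) S)"
  let ?C = "continuations X \<I> S"
  \<comment> \<open>The rank bound leaves room for \<open>m\<close> further elements beyond
    \<open>x\<close> and \<open>y\<close>, so an entry in column \<open>None\<close> is positive as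
    soon as \<open>x\<close> and \<open>y\<close> are not parallel.\<close>
  have adj: "atlas \<omega> X \<I> c m (insert x S) (Some y) None > 0"
    if "insert x (insert y S) \<in> \<I>" "x \<notin> S" "y \<notin> S" "x \<noteq> y" for x y
  proof -
    have "card (insert y (insert x S)) = card S + 2" using that finite_indep Suc.prems by simp
    then show ?thesis
      using that Suc.prems rank by (auto intro!: word_weight_pos[OF pos] simp: insert_commute)
  qed
  obtain a b where ab: "a \<in> X - S" "b \<in> X - S" "a \<noteq> b" "insert a (insert b S) \<in> \<I>"
    using extend_indep_twice[of S] Suc.prems rank by auto
  have abC: "a \<in> ?C" "b \<in> ?C" using ab subset_indep[OF ab(4)] by (auto simp: continuations_def)
  \<comment> \<open>Augmenting \<open>insert x S\<close> from \<open>insert a (insert b S)\<close>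
    shows that no \<open>x\<close> is parallel to both \<open>a\<close> and
    \<open>b\<close>.\<close>
  have conn: "insert a (insert x S) \<in> \<I> \<and> x \<noteq> a \<or> insert b (insert x S) \<in> \<I> \<and> x \<noteq> b" if "x \<in> ?C" for x
  proof -
    have "card (insert x S) < card (insert a (insert b S))"
      using that ab finite_indep Suc.prems by (simp add: continuations_def)
    with that ab obtain u where "u \<in> insert a (insert b S) - insert x S" "insert u (insert x S) \<in> \<I>"
      using augmentation[of "insert x S" "insert a (insert b S)"] by (auto simp: continuations_def)
    then show ?thesis by auto
  qed
  have "hyperbolic (atlas_index X) (\<lambda>i j. \<Sum>z\<in>Some ` ?C. (\<omega> \<circ> the) z * ?A z i j)"
  proof (rule hyperbolic_sum[where a = "Some a" and b = "Some b" and ?j0.0 = None])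
    show "hyperbolic (atlas_index X) (?A z)" if "z \<in> Some ` ?C" for z
      using that Suc finite_indep by (auto simp: continuations_def)
    show "?A z i j \<ge> 0" for z i j by (rule atlas_nonneg[OF pos c])
    show "?A x y j = ?A y x j" if "x \<in> Some ` ?C" "y \<in> Some ` ?C" for x y j
      using that atlas_exchange by (auto simp: continuations_def simp del: atlas.simps)
    show "?A (Some a) (Some b) None > 0" using ab adj by simp
    show "?A (Some a) x None > 0 \<or> ?A (Some b) x None > 0" if "x \<in> Some ` ?C" for x
      using that conn adj ab by (fastforce simp: continuations_def simp del: atlas.simps)
  qed (use finite_ground pos ab abC in \<open>auto simp: continuations_def\<close>)
  also have "(\<lambda>i j. \<Sum>z\<in>Some ` ?C. (\<omega> \<circ> the) z * ?A z i j) = atlas \<omega> X \<I> c (Suc m) S"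
  proof (intro ext)
    fix i j
    \<comment> \<open>Elements that are not continuations contribute zero, so Euler's sum shrinks to
      the set handled above.\<close>
    have "atlas \<omega> X \<I> c m (insert z S) i j = 0" if "z \<in> X - S - ?C" for z
      using that by (intro atlas_eq_0) (auto simp: continuations_def)
    then have "atlas \<omega> X \<I> c (Suc m) S i j = (\<Sum>z\<in>?C. \<omega> z * atlas \<omega> X \<I> c m (insert z S) i j)"
      unfolding atlas_Suc using finite_ground
      by (intro sum.mono_neutral_right) (auto simp: continuations_def)
    then show "(\<Sum>z\<in>Some ` ?C. (\<omega> \<circ> the) z * ?A z i j) = atlas \<omega> X \<I> c (Suc m) S i j"
      by (simp add: sum.reindex)
  qed
  finally show ?case .
qed

section \<open>Evaluation of the form in terms of the weighted counts\<close>

text \<open>Pairs \<open>(S, x)\<close> correspond to pairs \<open>(T, x)\<close> with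
  \<open>x\<close> in \<open>T\<close> and \<open>T = insert x S\<close>; each \<open>T\<close>
  occurs once for each of its \<open>Suc j\<close> elements.\<close>

lemma word_weight_double_count:
  "(\<Sum>S\<in>indep_of_card \<I> j. prod \<omega> S * word_weight \<omega> X \<I> (Suc m) S)
    = real (Suc j) * (\<Sum>T\<in>indep_of_card \<I> (Suc j). prod \<omega> T * word_weight \<omega> X \<I> m T)"
proof -
  let ?I = "indep_of_card \<I>"
  let ?E = "SIGMA S:?I j. {x\<in>X - S. insert x S \<in> \<I>}"
  have finI: "finite (?I i)" for i using finite_indeps by (simp add: indep_of_card_def)
  have "(\<Sum>S\<in>?I j. prod \<omega> S * word_weight \<omega> X \<I> (Suc m) S)
      = (\<Sum>S\<in>?I j. \<Sum>x\<in>{x\<in>X - S. insert x S \<in> \<I>}. prod \<omega> S * \<omega> x * word_weight \<omega> X \<I> m (insert x S))"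
  proof (rule sum.cong[OF refl])
    fix S
    show "prod \<omega> S * word_weight \<omega> X \<I> (Suc m) S
        = (\<Sum>x\<in>{x\<in>X - S. insert x S \<in> \<I>}. prod \<omega> S * \<omega> x * word_weight \<omega> X \<I> m (insert x S))"
      unfolding word_weight.simps sum_distrib_left using finite_ground word_weight_eq_0
      by (intro sum.mono_neutral_cong_right ballI) auto
  qed
  also have "\<dots> = (\<Sum>(S, x)\<in>?E. prod \<omega> S * \<omega> x * word_weight \<omega> X \<I> m (insert x S))"
    using finI finite_ground by (intro sum.Sigma) auto
  also have "\<dots> = (\<Sum>(T, x)\<in>(SIGMA T:?I (Suc j). T). prod \<omega> T * word_weight \<omega> X \<I> m T)"
    using finite_indep subset_indep subsetD[OF indep_subset_ground]
    by (intro sum.reindex_bij_witness[where i = "\<lambda>(T, x). (T - {x}, x)" and j = "\<lambda>(S, x). (insert x S, x)"])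
      (auto simp: indep_of_card_def insert_absorb mult_ac)
  also have "\<dots> = (\<Sum>T\<in>?I (Suc j). \<Sum>x\<in>T. prod \<omega> T * word_weight \<omega> X \<I> m T)"
    using finI finite_indep by (intro sum.Sigma[symmetric]) (auto simp: indep_of_card_def)
  also have "\<dots> = real (Suc j) * (\<Sum>T\<in>?I (Suc j). prod \<omega> T * word_weight \<omega> X \<I> m T)"
    unfolding sum_distrib_left by (intro sum.cong) (auto simp: indep_of_card_def)
  finally show ?thesis .
qed

lemma word_weight_empty: "word_weight \<omega> X \<I> m {} = fact m * weighted_indep \<omega> \<I> m"
proof -
  \<comment> \<open>General \<open>j\<close> is needed because each double count lowers
    \<open>m\<close> and raises \<open>j\<close>; the factors \<open>Suc j\<close> accumulate to the
    quotient of the factorials.\<close>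
  have "fact j * (\<Sum>S\<in>indep_of_card \<I> j. prod \<omega> S * word_weight \<omega> X \<I> m S)
      = fact (j + m) * weighted_indep \<omega> \<I> (j + m)" for j
  proof (induction m arbitrary: j)
    case 0
    show ?case by (auto simp: weighted_indep_def indep_of_card_def intro!: sum.cong)
  next
    case (Suc m)
    show ?case using Suc[of "Suc j"] unfolding word_weight_double_count by (simp add: mult_ac)
  qed
  from this[of 0] have "(\<Sum>S\<in>indep_of_card \<I> 0. prod \<omega> S * word_weight \<omega> X \<I> m S)
      = fact m * weighted_indep \<omega> \<I> m" by simp
  moreover have "indep_of_card \<I> 0 = {{}}"
    using empty_indep finite_indep by (auto simp: indep_of_card_def)
  ultimately show ?thesis by simp
qed

text \<open>Euler's formula again: pairing with \<open>v\<close> restores the weights of the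
  differentiated elements. With \<open>m = k - 1\<close> the three values are multiples of the
  weighted counts for \<open>k + 1\<close>, \<open>k\<close> and \<open>k - 1\<close>.\<close>

lemma bform_atlas_empty:
  fixes \<omega> :: "'a \<Rightarrow> real"
  defines "v \<equiv> \<lambda>i. case i of None \<Rightarrow> 0 | Some x \<Rightarrow> \<omega> x" and "e \<equiv> \<lambda>i. of_bool (i = None)"
  shows "bform (atlas_index X) (atlas \<omega> X \<I> c m {}) v v = word_weight \<omega> X \<I> (m + 2) {}"
    and "bform (atlas_index X) (atlas \<omega> X \<I> c m {}) e v = word_weight \<omega> X \<I> (m + 1) {}"
    and "bform (atlas_index X) (atlas \<omega> X \<I> c m {}) e e = c * word_weight \<omega> X \<I> m {}"
proof -
  note form = bform_atlas_index[OF finite_ground, of "atlas \<omega> X \<I> c m {}"]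
  have "(\<Sum>y\<in>X. of_bool (x \<noteq> y) * word_weight \<omega> X \<I> m {x, y} * \<omega> x * \<omega> y)
      = \<omega> x * (\<Sum>y\<in>X - {x}. \<omega> y * word_weight \<omega> X \<I> m {y, x})" for x
    unfolding sum_distrib_left using finite_ground
    by (intro sum.mono_neutral_cong_right) (auto simp: insert_commute)
  then show "bform (atlas_index X) (atlas \<omega> X \<I> c m {}) v v = word_weight \<omega> X \<I> (m + 2) {}"
    by (simp add: form v_def numeral_2_eq_2)
qed (simp_all add: bform_atlas_index[OF finite_ground] v_def e_def mult_ac)

end

theorem theorem1p6:
  fixes X :: "'a set" and \<I> :: "'a set set" and \<omega> :: "'a \<Rightarrow> real" and n k :: nat
  assumes "matroid X \<I>"
    and "card X = n"
    and "\<And>x. x \<in> X \<Longrightarrow> \<omega> x > 0"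
    and "1 \<le> k" and "k < matroid_rank \<I>"
  shows "(weighted_indep \<omega> \<I> k)\<^sup>2 \<ge>
    (1 + 1 / real k) * (1 + 1 / (real (max_parallel X \<I> (k - 1)) - 1)) *
      weighted_indep \<omega> \<I> (k - 1) * weighted_indep \<omega> \<I> (k + 1)"
proof -
  interpret matroid X \<I> by fact
  obtain m where k: "k = Suc m" using assms(4) by (cases k) auto
  define p where "p = max_parallel X \<I> m"
  define c where "c = 1 + 1 / (real p - 1)"
  define W where "W = weighted_indep \<omega> \<I>"
  let ?Q = "bform (atlas_index X) (atlas \<omega> X \<I> c m {})"
  let ?v = "\<lambda>i. case i of None \<Rightarrow> 0 | Some x \<Rightarrow> \<omega> x" and ?e = "\<lambda>i. of_bool (i = None)"
  have rank: "m + 2 \<le> matroid_rank \<I>" using assms(5) k by simp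
  have p: "2 \<le> p" unfolding p_def by (rule max_parallel_ge_2[OF rank])
  have "hyperbolic (atlas_index X) (atlas \<omega> X \<I> c m {})"
  proof (rule hyperbolic_atlas[OF assms(3) _ _ rank])
    show "c \<ge> 0" using p by (simp add: c_def)
    show "hyperbolic (atlas_index X) (atlas \<omega> X \<I> c 0 S)" if "S \<in> \<I>" "card S = m" for S
      unfolding c_def using that p card_parallel_classes_le[of S]
      by (intro hyperbolic_atlas_0) (auto simp: p_def)
  qed (use empty_indep in auto)
  \<comment> \<open>Here \<open>k < matroid_rank \<I>\<close> is used: some independent set has
    \<open>m + 2 = k + 1\<close> elements.\<close>
  moreover have "?Q ?v ?v > 0"
    unfolding bform_atlas_empty using rank empty_indep by (intro word_weight_pos[OF assms(3)]) auto
  ultimately have "?Q ?e ?e * ?Q ?v ?v \<le> (?Q ?e ?v)\<^sup>2"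
    unfolding hyperbolic_def by blast
  then have le: "c * (fact m * W m) * (fact (m + 2) * W (m + 2)) \<le> (fact (m + 1) * W (m + 1))\<^sup>2"
    unfolding bform_atlas_empty word_weight_empty W_def .
  have "(fact (m + 1))\<^sup>2 * ((1 + 1 / real k) * c * W m * W (m + 2)) \<le> (fact (m + 1))\<^sup>2 * (W (m + 1))\<^sup>2"
  proof -
    \<comment> \<open>The factor \<open>1 + 1 / real k\<close> is \<open>(m + 2) / (m + 1)\<close>,
      left over from the factorials that count orderings.\<close>
    have "(fact (m + 1))\<^sup>2 * (1 + 1 / real k) = fact m * (fact (m + 2) :: real)"
      by (simp add: k power2_eq_square field_simps)
    then have "(fact (m + 1))\<^sup>2 * ((1 + 1 / real k) * c * W m * W (m + 2))
        = c * (fact m * W m) * (fact (m + 2) * W (m + 2))"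
      by (metis (no_types, opaque_lifting) mult.assoc mult.left_commute)
    then show ?thesis using le by (simp only: power_mult_distrib)
  qed
  then have "(1 + 1 / real k) * c * W m * W (m + 2) \<le> (W (m + 1))\<^sup>2"
    by (rule mult_left_le_imp_le) simp
  then show ?thesis by (simp add: k W_def c_def p_def)
qed

end
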